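(* Let $P=\{x\in\mathbb{R}^n \mid (x,a_i)+b_i\geq 0,\ i=1,\dots,m\}$ be a simple $n$-dimensional polytope with $m$ facets, and let $L(P)$ be the double of $P$. Then $$h(L(P))(\alpha,t)=(\alpha+t)^{m-n}\,h(P)(\alpha^2,t^2).$$
   Context: Let $P=\{x\in\mathbb{R}^n \mid (x,a_i)+b_i\geq 0,\ i=1,\dots,m\}$, with $a_i\in\mathbb{R}^n$ and $b_i\in\mathbb{R}$, be a simple $n$-dimensional (bounded) polytope with exactly $m$ facets (so each inequality defines a facet). Let $i_P:\mathbb{R}^n\to\mathbb{R}^m$ be the affine map $i_P(x)=A_Px+b_P$, where $A_P$ is the $m\times n$ matrix with rows $a_i$ and $b_P=(b_1,\dots,b_m)$ is a column vector. Then $i_P$ identifies $P$ with $i_P(\mathbb{R}^n)\cap\mathbb{R}^m_{\geq}$, where $\mathbb{R}^m_{\geq}$ is the set of points with all coordinates nonnegative. Specify the affine subspace $i_P(\mathbb{R}^n)\subset\mathbb{R}^m$ by a system of $m-n$ linear equations $$\sum_{i=1}^m c_{j,i}x_i=q_j,\qquad j=1,\dots,m-n.$$ The double of $P$ is the polytope $$L(P)=\Bigl\{(x_1,\dots,x_m,x_1',\dots,x_m')\in\mathbb{R}^{2m}_{\geq}\ \Bigm|\ \sum_{i=1}^m c_{j,i}(x_i+x_i')=q_j,\ j=1,\dots,m-n\Bigr\};$$ it is a simple $(m+n)$-dimensional polytope with $2m$ facets. For a simple polytope $Q$ of dimension $d$, let $f_{d-i,i}$ be the number of (nonempty) faces of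 $Q$ of dimension $d-i$, put $f(Q)(\alpha,t)=\alpha^d+f_{d-1,1}\alpha^{d-1}t+\dots+f_{0,d}t^d$, and define the $h$-polynomial by $h(Q)(\alpha,t)=f(Q)(\alpha-t,t)$. *)

theory Defs
  imports "HOL-Analysis.Analysis"
begin

definition ineq_polyhedron :: "('m \<Rightarrow> real^'n) \<Rightarrow> ('m \<Rightarrow> real) \<Rightarrow> (real^'n) set" where
  "ineq_polyhedron a b = {x. \<forall>i. x \<bullet> a i + b i \<ge> 0}"

definition simple_polytope :: "'a::euclidean_space set \<Rightarrow> bool" where
  "simple_polytope Q \<longleftrightarrow> polytope Q \<and>
     (\<forall>v. v extreme_point_of Q \<longrightarrow> int (card {F. F facet_of Q \<and> v \<in> F}) = aff_dim Q)"

definition slack_map :: "('m::finite \<Rightarrow> real^'n) \<Rightarrow> ('m \<Rightarrow> real) \<Rightarrow> real^'n \<Rightarrow> real^'m" where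
  "slack_map a b x = (\<chi> i. a i) *v x + (\<chi> i. b i)"

definition solution_set :: "nat \<Rightarrow> (nat \<Rightarrow> 'm::finite \<Rightarrow> real) \<Rightarrow> (nat \<Rightarrow> real) \<Rightarrow> (real^'m) set" where
  "solution_set k c q = {y. \<forall>j\<in>{1..k}. (\<Sum>i\<in>UNIV. c j i * y $ i) = q j}"

text \<open>The coordinates of a point of the double are indexed by a disjoint sum:
  \<open>Inl i\<close> stands for the coordinate $x_i$ and \<open>Inr i\<close> for the coordinate $x'_i$.\<close>

definition double :: "nat \<Rightarrow> (nat \<Rightarrow> 'm::finite \<Rightarrow> real) \<Rightarrow> (nat \<Rightarrow> real) \<Rightarrow> (real^('m + 'm)) set" where
  "double k c q = {z. (\<forall>s. z $ s \<ge> 0) \<and>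
     (\<forall>j\<in>{1..k}. (\<Sum>i\<in>UNIV. c j i * (z $ Inl i + z $ Inr i)) = q j)}"

text \<open>The library counts the empty set as a face, of affine dimension $-1$; it is excluded
  here because the dimension is a natural number.\<close>

definition num_faces :: "'a::euclidean_space set \<Rightarrow> nat \<Rightarrow> nat" where
  "num_faces Q k = card {F. F face_of Q \<and> aff_dim F = int k}"

text \<open>The bivariate polynomials are given by their values at elements of an arbitrary commutative
  ring. An identity between such values over all commutative rings is an identity of polynomials
  with integer coefficients, as one may take the polynomial ring itself and its two variables.\<close>

definition f_polynomial :: "'a::euclidean_space set \<Rightarrow> 'r::comm_ring_1 \<Rightarrow> 'r \<Rightarrow> 'r" where
  "f_polynomial Q \<alpha> t = (let d = nat (aff_dim Q) in
     \<alpha> ^ d + (\<Sum>i=1..d. of_nat (num_faces Q (d - i)) * \<alpha> ^ (d - i) * t ^ i))"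

definition h_polynomial :: "'a::euclidean_space set \<Rightarrow> 'r::comm_ring_1 \<Rightarrow> 'r \<Rightarrow> 'r" where
  "h_polynomial Q \<alpha> t = f_polynomial Q (\<alpha> - t) t"

end

theory Submission
  imports Defs
begin

text \<open>
  A nonempty face of a polyhedron given by finitely many inequalities is determined by its tight
  set, the set of inequalities that hold with equality at its relative interior points, and each
  point of the polyhedron is relative interior to exactly one face. For the simple polytope \<open>P\<close>
  with an irredundant description the normals in a tight set are linearly independent, so the face
  has codimension equal to the size of its tight set (\<open>simple_polytope_imp_simple_system\<close>). Hence
  \<open>f(P)(\<alpha>, t)\<close> is the sum of \<open>\<alpha> ^ (n - card I) * t ^ card I\<close> over the tight sets \<open>I\<close> of \<open>P\<close>
  (\<open>f_polynomial_simple_system\<close>).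

  A point of the double amounts to a point \<open>x\<close> of \<open>P\<close> together with a way to write each slack
  \<open>(x, a\<^sub>i) + b\<^sub>i\<close> as a sum of two nonnegative numbers: up to an injective affine map, the double is
  the polyhedron of all pairs \<open>(x, w)\<close> with \<open>0 \<le> w\<^sub>i \<le> (x, a\<^sub>i) + b\<^sub>i\<close>. The two parts of slack \<open>i\<close> vanish
  together exactly when \<open>i\<close> is tight at \<open>x\<close>; for every other \<open>i\<close> either no part vanishes or just one
  of the two does, and all these choices are possible independently of each other
  (\<open>tight_sets_split\<close>). So a tight set \<open>I\<close> of \<open>P\<close> with \<open>k\<close> elements accounts for the tight sets of
  the double whose generating function is \<open>(t\<^sup>2) ^ k * (\<alpha> + 2 * t) ^ (m - k)\<close>, with weight \<open>t\<close> for
  every vanishing part and \<open>\<alpha>\<close> for every \<open>i\<close> without one (\<open>sum_fibre_both\<close>). The \<open>n - k\<close> dimensions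
  of the face of \<open>P\<close> contribute a further \<open>\<alpha> ^ (n - k)\<close>, and the sum over \<open>I\<close> is
  \<open>f(L(P))(\<alpha>, t) = (\<alpha> + 2 * t) ^ (m - n) * f(P)(\<alpha> * (\<alpha> + 2 * t), t\<^sup>2)\<close>.
  Replacing \<open>\<alpha>\<close> by \<open>\<alpha> - t\<close> turns \<open>\<alpha> + 2 * t\<close> into \<open>\<alpha> + t\<close> and \<open>\<alpha> * (\<alpha> + 2 * t)\<close> into
  \<open>\<alpha>\<^sup>2 - t\<^sup>2\<close>, which is the claim.
\<close>

section \<open>Linearly independent families\<close>

text \<open>Independence is stated for families, so that a repeated vector counts as a dependence; the
  cardinality of the index set is then the rank.\<close>

definition independent_family :: "('i \<Rightarrow> 'a::real_vector) \<Rightarrow> 'i set \<Rightarrow> bool" where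
  "independent_family a Z \<longleftrightarrow> (\<forall>r. (\<Sum>i\<in>Z. r i *\<^sub>R a i) = 0 \<longrightarrow> (\<forall>i\<in>Z. r i = 0))"

lemma independent_familyD:
  "independent_family a Z \<Longrightarrow> (\<Sum>i\<in>Z. r i *\<^sub>R a i) = 0 \<Longrightarrow> i \<in> Z \<Longrightarrow> r i = 0"
  unfolding independent_family_def by blast

lemma independent_family_subset:
  assumes "independent_family a Z" "Y \<subseteq> Z" "finite Z"
  shows "independent_family a Y"
  unfolding independent_family_def
proof (intro allI impI ballI)
  fix r i assume r: "(\<Sum>i\<in>Y. r i *\<^sub>R a i) = 0" and i: "i \<in> Y"
  have "(\<Sum>i\<in>Z. (if i \<in> Y then r i else 0) *\<^sub>R a i) = (\<Sum>i\<in>Y. r i *\<^sub>R a i)"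
    using assms by (intro sum.mono_neutral_cong_right) auto
  with independent_familyD[OF assms(1), of "\<lambda>i. if i \<in> Y then r i else 0" i] r i assms(2)
  show "r i = 0" by auto
qed

lemma independent_family_imp_inj_on:
  assumes "independent_family a Z" "finite Z"
  shows "inj_on a Z"
proof (rule inj_onI)
  fix i j assume ij: "i \<in> Z" "j \<in> Z" "a i = a j"
  show "i = j"
  proof (rule ccontr)
    assume "i \<noteq> j"
    have "independent_family a {i, j}"
      using assms ij by (auto intro: independent_family_subset[OF assms(1)])
    from independent_familyD[OF this, of "\<lambda>k. if k = i then 1 else -1" i] \<open>i \<noteq> j\<close> ij
    show False by simp
  qed
qed

lemma independent_family_iff_dim:
  fixes a :: "'i \<Rightarrow> 'a::euclidean_space"
  assumes "finite Z"
  shows "independent_family a Z \<longleftrightarrow> dim (a ` Z) = card Z"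
proof
  assume ind: "independent_family a Z"
  note inj = independent_family_imp_inj_on[OF ind assms]
  have "independent (a ` Z)"
    unfolding independent_explicit
    using assms ind by (auto simp: sum.reindex[OF inj] intro: independent_familyD)
  then show "dim (a ` Z) = card Z"
    by (simp add: dim_eq_card_independent card_image[OF inj])
next
  assume d: "dim (a ` Z) = card Z"
  have "dim (a ` Z) \<le> card (a ` Z)"
    using assms by (simp add: dim_le_card')
  with d card_image_le[OF assms, of a] have c: "card (a ` Z) = card Z"
    by simp
  then have inj: "inj_on a Z"
    using assms by (rule eq_card_imp_inj_on[rotated])
  have "independent (a ` Z)"
    using assms d c by (intro card_le_dim_spanning[of _ "a ` Z"]) (auto simp: span_superset)
  then have *: "\<And>u v. (\<Sum>v\<in>a ` Z. u v *\<^sub>R v) = 0 \<Longrightarrow> v \<in> a ` Z \<Longrightarrow> u v = 0"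
    unfolding independent_explicit by blast
  show "independent_family a Z"
    unfolding independent_family_def
  proof (intro allI impI ballI)
    fix r i assume r: "(\<Sum>i\<in>Z. r i *\<^sub>R a i) = 0" and i: "i \<in> Z"
    have "(\<Sum>v\<in>a ` Z. r (the_inv_into Z a v) *\<^sub>R v) = 0"
      using r by (simp add: sum.reindex[OF inj] the_inv_into_f_f[OF inj])
    from *[OF this, of "a i"] i show "r i = 0"
      by (simp add: the_inv_into_f_f[OF inj])
  qed
qed

lemma dim_orthogonal_family:
  fixes a :: "'i \<Rightarrow> 'a::euclidean_space"
  shows "dim {u. \<forall>i\<in>Z. u \<bullet> a i = 0} + dim (a ` Z) = DIM('a)"
proof -
  have "(\<forall>i\<in>Z. u \<bullet> a i = 0) \<longleftrightarrow> (\<forall>x\<in>span (a ` Z). orthogonal x u)" for u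
  proof
    assume "\<forall>i\<in>Z. u \<bullet> a i = 0"
    have "orthogonal u x" if "x \<in> span (a ` Z)" for x
      by (rule orthogonal_to_span[OF that]) (use \<open>\<forall>i\<in>Z. u \<bullet> a i = 0\<close> in \<open>auto simp: orthogonal_def\<close>)
    then show "\<forall>x\<in>span (a ` Z). orthogonal x u"
      by (simp add: orthogonal_commute)
  next
    assume *: "\<forall>x\<in>span (a ` Z). orthogonal x u"
    show "\<forall>i\<in>Z. u \<bullet> a i = 0"
    proof
      fix i assume "i \<in> Z"
      then have "a i \<in> span (a ` Z)" by (intro span_base imageI)
      with * show "u \<bullet> a i = 0" by (metis orthogonal_def inner_commute)
    qed
  qed
  then have "{u. \<forall>i\<in>Z. u \<bullet> a i = 0} = {u \<in> UNIV. \<forall>x\<in>span (a ` Z). orthogonal x u}"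
    by blast
  moreover have "dim {u \<in> UNIV. \<forall>x\<in>span (a ` Z). orthogonal x u} + dim (span (a ` Z)) = dim (UNIV :: 'a set)"
    by (rule dim_subspace_orthogonal_to_vectors) auto
  ultimately show ?thesis
    by (simp only: dim_span dim_UNIV)
qed

section \<open>Faces of an intersection of half-spaces\<close>

definition halfspaces :: "('i \<Rightarrow> 'a::euclidean_space) \<Rightarrow> ('i \<Rightarrow> real) \<Rightarrow> 'a set" where
  "halfspaces a b = {x. \<forall>i. x \<bullet> a i + b i \<ge> 0}"

definition tight :: "('i \<Rightarrow> 'a::euclidean_space) \<Rightarrow> ('i \<Rightarrow> real) \<Rightarrow> 'a \<Rightarrow> 'i set" where
  "tight a b x = {i. x \<bullet> a i + b i = 0}"

definition tight_sets :: "('i \<Rightarrow> 'a::euclidean_space) \<Rightarrow> ('i \<Rightarrow> real) \<Rightarrow> 'i set set" where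
  "tight_sets a b = tight a b ` halfspaces a b"

definition tight_face :: "('i \<Rightarrow> 'a::euclidean_space) \<Rightarrow> ('i \<Rightarrow> real) \<Rightarrow> 'i set \<Rightarrow> 'a set" where
  "tight_face a b Z = {x \<in> halfspaces a b. Z \<subseteq> tight a b x}"

lemma slack_affine_combination:
  fixes x y v :: "'a::real_inner"
  shows "u + w = 1 \<Longrightarrow> (u *\<^sub>R x + w *\<^sub>R y) \<bullet> v + \<beta> = u * (x \<bullet> v + \<beta>) + w * (y \<bullet> v + \<beta>)"
proof -
  assume "u + w = 1"
  then have "\<beta> = u * \<beta> + w * \<beta>" by (metis distrib_right mult_1)
  then show ?thesis by (simp add: inner_add_left algebra_simps)
qed

lemma convex_halfspaces: "convex (halfspaces a b)"
  unfolding convex_def halfspaces_def by (auto simp: slack_affine_combination)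

text \<open>A convex combination of nonnegative slacks with positive weights vanishes only if every slack
  does.\<close>

lemma tight_face_face_of: "tight_face a b Z face_of halfspaces a b"
  unfolding face_of_def
proof (intro conjI ballI impI)
  show "tight_face a b Z \<subseteq> halfspaces a b"
    by (auto simp: tight_face_def)
  show "convex (tight_face a b Z)"
    unfolding convex_def tight_face_def halfspaces_def tight_def
    by (auto simp: slack_affine_combination subset_iff)
next
  fix x y z assume xy: "x \<in> halfspaces a b" "y \<in> halfspaces a b"
    and z: "z \<in> tight_face a b Z" "z \<in> open_segment x y"
  from z(2) obtain u where u: "0 < u" "u < 1" "z = (1 - u) *\<^sub>R x + u *\<^sub>R y"
    by (auto simp: in_segment)
  have "x \<bullet> a i + b i = 0 \<and> y \<bullet> a i + b i = 0" if "i \<in> Z" for i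
  proof -
    have "z \<bullet> a i + b i = 0"
      using z(1) that by (auto simp: tight_face_def tight_def)
    then have "(1 - u) * (x \<bullet> a i + b i) + u * (y \<bullet> a i + b i) = 0"
      using slack_affine_combination[of "1 - u" u x y "a i" "b i"] u by simp
    moreover have "0 \<le> (1 - u) * (x \<bullet> a i + b i)" "0 \<le> u * (y \<bullet> a i + b i)"
      using xy u by (auto simp: halfspaces_def)
    ultimately show ?thesis
      using u by (simp add: add_nonneg_eq_0_iff)
  qed
  then show "x \<in> tight_face a b Z" "y \<in> tight_face a b Z"
    using xy by (auto simp: tight_face_def tight_def)
qed

text \<open>Two extension arguments. From the relative interior point \<open>y\<close> a segment starting at any point of
  \<open>F\<close> can be prolonged within \<open>F\<close>, which forces the inequalities tight at \<open>y\<close> to be tight on \<open>F\<close>.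
  Conversely a segment from a point where these are tight can be prolonged beyond \<open>y\<close> within the
  polyhedron, because the other inequalities are strict at \<open>y\<close>; the face property then puts its
  endpoints in \<open>F\<close>.\<close>

lemma face_eq_tight_face:
  fixes a :: "'i::finite \<Rightarrow> 'a::euclidean_space"
  assumes F: "F face_of halfspaces a b" and y: "y \<in> rel_interior F"
  shows "F = tight_face a b (tight a b y)"
proof
  have cF: "convex F" using F by (rule face_of_imp_convex)
  have yF: "y \<in> F" using y rel_interior_subset by blast
  have FP: "F \<subseteq> halfspaces a b" using F by (rule face_of_imp_subset)
  show "F \<subseteq> tight_face a b (tight a b y)"
  proof
    fix z assume z: "z \<in> F"
    then obtain e where e: "e > 1" "(1 - e) *\<^sub>R z + e *\<^sub>R y \<in> F"
      using convex_rel_interior_iff[OF cF, of y] y by blast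
    have "z \<bullet> a i + b i = 0" if i: "i \<in> tight a b y" for i
    proof -
      have "0 \<le> ((1 - e) *\<^sub>R z + e *\<^sub>R y) \<bullet> a i + b i"
        using e FP by (auto simp: halfspaces_def)
      also have "\<dots> = (1 - e) * (z \<bullet> a i + b i)"
        using i slack_affine_combination[of "1 - e" e z y "a i" "b i"] by (simp add: tight_def)
      finally have "z \<bullet> a i + b i \<le> 0"
        using e by (simp add: zero_le_mult_iff)
      moreover have "0 \<le> z \<bullet> a i + b i"
        using z FP by (auto simp: halfspaces_def)
      ultimately show ?thesis by simp
    qed
    then show "z \<in> tight_face a b (tight a b y)"
      using z FP by (auto simp: tight_face_def tight_def)
  qed
  show "tight_face a b (tight a b y) \<subseteq> F"
  proof
    fix z assume z: "z \<in> tight_face a b (tight a b y)"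
    then have zP: "z \<in> halfspaces a b" by (simp add: tight_face_def)
    \<comment> \<open>the ray from \<open>z\<close> through \<open>y\<close>, continued beyond \<open>y\<close>\<close>
    define g where "g = (\<lambda>e::real. (1 + e) *\<^sub>R y + (- e) *\<^sub>R z)"
    have g: "g e \<bullet> a i + b i = (1 + e) * (y \<bullet> a i + b i) + (- e) * (z \<bullet> a i + b i)" for e i
      unfolding g_def by (rule slack_affine_combination) simp
    have "\<forall>\<^sub>F e in at_right 0. g e \<bullet> a i + b i \<ge> 0" for i
    proof (cases "i \<in> tight a b y")
      case True
      then have "z \<bullet> a i + b i = 0" "y \<bullet> a i + b i = 0"
        using z by (auto simp: tight_face_def tight_def)
      then show ?thesis by (simp only: g) simp
    next
      case False
      then have "0 < y \<bullet> a i + b i"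
        using yF FP by (force simp: tight_def halfspaces_def order_less_le)
      moreover have "((\<lambda>e. g e \<bullet> a i + b i) \<longlongrightarrow> y \<bullet> a i + b i) (at_right 0)"
        unfolding g_def by (rule tendsto_eq_intros refl | simp)+
      ultimately have "\<forall>\<^sub>F e in at_right 0. 0 < g e \<bullet> a i + b i"
        by (rule order_tendstoD(1)[rotated])
      then show ?thesis by (rule eventually_mono) simp
    qed
    then have "\<forall>\<^sub>F e in at_right 0. \<forall>i. g e \<bullet> a i + b i \<ge> 0"
      by (simp add: eventually_all_finite)
    then have "\<forall>\<^sub>F e in at_right 0. g e \<in> halfspaces a b \<and> e > 0"
      by (auto simp: halfspaces_def eventually_conj_iff eventually_at_right_less)
    then obtain e where e: "g e \<in> halfspaces a b" "e > 0"
      using eventually_happens[of _ "at_right (0::real)"] by (auto simp: trivial_limit_at_right_real)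
    show "z \<in> F"
    proof (cases "y = z")
      case False
      have "1 / (1 + e) + e / (1 + e) = 1"
        using e(2) by (simp add: add_divide_distrib[symmetric])
      then have "(1 / (1 + e)) *\<^sub>R y + (e / (1 + e)) *\<^sub>R y = y"
        by (metis scaleR_add_left scaleR_one)
      then have "y = (1 - 1 / (1 + e)) *\<^sub>R z + (1 / (1 + e)) *\<^sub>R g e"
        using e(2) by (simp add: g_def algebra_simps divide_simps)
      moreover have "z \<noteq> g e"
      proof
        assume "z = g e"
        then have "(1 + e) *\<^sub>R z = (1 + e) *\<^sub>R y"
          by (simp add: g_def algebra_simps)
        then show False
          using False e(2) by simp
      qed
      ultimately have "y \<in> open_segment z (g e)"
        using e(2) by (auto simp: in_segment intro!: exI[of _ "1 / (1 + e)"])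
      then show ?thesis
        using F zP e(1) yF unfolding face_of_def by blast
    qed (use yF in simp)
  qed
qed

lemma tight_face_tight_sets_inj: "inj_on (tight_face a b) (tight_sets a b)"
  unfolding inj_on_def tight_sets_def tight_face_def by blast

lemma nonempty_faces_eq:
  fixes a :: "'i::finite \<Rightarrow> 'a::euclidean_space"
  shows "{F. F face_of halfspaces a b \<and> F \<noteq> {}} = tight_face a b ` tight_sets a b"
proof (intro set_eqI iffI; clarsimp)
  fix F assume F: "F face_of halfspaces a b" "F \<noteq> {}"
  then obtain y where y: "y \<in> rel_interior F"
    using rel_interior_eq_empty[OF face_of_imp_convex[OF F(1)]] by blast
  then have "y \<in> halfspaces a b"
    using rel_interior_subset face_of_imp_subset[OF F(1)] by blast
  with face_eq_tight_face[OF F(1) y]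
  show "F \<in> tight_face a b ` tight_sets a b"
    by (auto simp: tight_sets_def)
next
  fix Z assume "Z \<in> tight_sets a b"
  then show "tight_face a b Z face_of halfspaces a b \<and> tight_face a b Z \<noteq> {}"
    by (auto simp: tight_face_face_of tight_sets_def) (auto simp: tight_face_def)
qed

text \<open>The tight equations cut out an affine space \<open>H\<close>, and the face contains the nonempty subset of
  \<open>H\<close>, open in \<open>H\<close>, on which the remaining inequalities are strict; hence both have the same
  dimension.\<close>

lemma aff_dim_tight_face:
  fixes a :: "'i::finite \<Rightarrow> 'a::euclidean_space"
  assumes "Z \<in> tight_sets a b"
  shows "aff_dim (tight_face a b Z) + int (dim (a ` Z)) = int DIM('a)"
proof -
  obtain y where y: "y \<in> halfspaces a b" "Z = tight a b y"
    using assms by (auto simp: tight_sets_def)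
  define H where "H = {x. \<forall>i\<in>Z. x \<bullet> a i + b i = 0}"
  define U where "U = (\<Inter>i\<in>-Z. {x. x \<bullet> a i + b i > 0})"
  have H: "H = (+) y ` {u. \<forall>i\<in>Z. u \<bullet> a i = 0}"
  proof (intro set_eqI iffI)
    fix x assume "x \<in> H"
    then have "x - y \<in> {u. \<forall>i\<in>Z. u \<bullet> a i = 0}"
      using y by (auto simp: H_def tight_def inner_diff_left)
    then show "x \<in> (+) y ` {u. \<forall>i\<in>Z. u \<bullet> a i = 0}"
      by (force intro: image_eqI[of _ _ "x - y"])
  qed (use y in \<open>auto simp: H_def tight_def inner_add_left\<close>)
  have sub: "subspace {u. \<forall>i\<in>Z. u \<bullet> a i = 0}"
    by (auto simp: subspace_def inner_add_left)
  have "affine H"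
    unfolding H affine_translation[symmetric] by (rule subspace_imp_affine[OF sub])
  moreover have "open U"
    unfolding U_def by (intro open_INT finite ballI open_Collect_less continuous_intros)
  moreover have "y \<in> H \<inter> U"
    using y by (force simp: H_def U_def tight_def halfspaces_def order_less_le)
  ultimately have "affine hull (H \<inter> U) = affine hull H"
    by (intro affine_hull_affine_Int_open) auto
  then have "aff_dim (H \<inter> U) = aff_dim H"
    by (metis aff_dim_affine_hull)
  moreover have "H \<inter> U \<subseteq> tight_face a b Z"
  proof
    fix x assume x: "x \<in> H \<inter> U"
    then have "x \<bullet> a i + b i \<ge> 0" for i
      by (cases "i \<in> Z") (auto simp: H_def U_def intro: less_imp_le)
    with x show "x \<in> tight_face a b Z"
      by (auto simp: H_def tight_face_def halfspaces_def tight_def)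
  qed
  moreover have "tight_face a b Z \<subseteq> H"
    by (auto simp: H_def tight_face_def tight_def)
  ultimately have "aff_dim (tight_face a b Z) = aff_dim H"
    by (metis aff_dim_subset order_antisym)
  also have "\<dots> = int (dim {u. \<forall>i\<in>Z. u \<bullet> a i = 0})"
    unfolding H aff_dim_translation_eq by (rule aff_dim_subspace[OF sub])
  finally show ?thesis
    using dim_orthogonal_family[of Z a] by simp
qed

section \<open>Simple systems of inequalities\<close>

text \<open>The empty tight set says that some point satisfies all inequalities strictly, so the
  polyhedron is full-dimensional.\<close>

definition simple_system :: "('i::finite \<Rightarrow> 'a::euclidean_space) \<Rightarrow> ('i \<Rightarrow> real) \<Rightarrow> bool" where
  "simple_system a b \<longleftrightarrow>
     {} \<in> tight_sets a b \<and> (\<forall>Z\<in>tight_sets a b. independent_family a Z)"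

lemma simple_system_aff_dim_tight_face:
  fixes a :: "'i::finite \<Rightarrow> 'a::euclidean_space"
  assumes "simple_system a b" "Z \<in> tight_sets a b"
  shows "aff_dim (tight_face a b Z) + int (card Z) = int DIM('a)"
  using aff_dim_tight_face[OF assms(2)] independent_family_iff_dim[of Z a] assms
  by (simp add: simple_system_def)

lemma simple_system_aff_dim:
  fixes a :: "'i::finite \<Rightarrow> 'a::euclidean_space"
  assumes "simple_system a b"
  shows "aff_dim (halfspaces a b) = int DIM('a)"
  using simple_system_aff_dim_tight_face[OF assms, of "{}"] assms
  by (simp add: simple_system_def tight_face_def)

lemma simple_system_card_le:
  fixes a :: "'i::finite \<Rightarrow> 'a::euclidean_space"
  assumes "simple_system a b" "Z \<in> tight_sets a b"
  shows "card Z \<le> DIM('a)"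
  using aff_dim_tight_face[OF assms(2)] independent_family_iff_dim[of Z a] assms
    dim_subset_UNIV[of "a ` Z"]
  by (simp add: simple_system_def)

lemma num_faces_simple_system:
  fixes a :: "'i::finite \<Rightarrow> 'a::euclidean_space"
  assumes S: "simple_system a b" and k: "k \<le> DIM('a)"
  shows "num_faces (halfspaces a b) (DIM('a) - k) = card {Z \<in> tight_sets a b. card Z = k}"
proof -
  have "{F. F face_of halfspaces a b \<and> aff_dim F = int (DIM('a) - k)} =
        {F \<in> {F. F face_of halfspaces a b \<and> F \<noteq> {}}. aff_dim F = int (DIM('a) - k)}"
    by auto
  also have "\<dots> = tight_face a b ` {Z \<in> tight_sets a b. card Z = k}"
    unfolding nonempty_faces_eq
    using simple_system_aff_dim_tight_face[OF S] k by force
  finally show ?thesis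
    unfolding num_faces_def
    by (simp add: card_image inj_on_subset[OF tight_face_tight_sets_inj])
qed

text \<open>The leading term \<open>\<alpha> ^ d\<close> of the \<open>f\<close>-polynomial is the contribution of the empty tight set,
  that is, of the polyhedron as a face of itself.\<close>

lemma f_polynomial_simple_system:
  fixes a :: "'i::finite \<Rightarrow> 'a::euclidean_space" and \<alpha> t :: "'r::comm_ring_1"
  assumes S: "simple_system a b"
  shows "f_polynomial (halfspaces a b) \<alpha> t =
    (\<Sum>Z\<in>tight_sets a b. \<alpha> ^ (DIM('a) - card Z) * t ^ card Z)"
proof -
  let ?d = "DIM('a)"
  let ?g = "\<lambda>k. of_nat (card {Z \<in> tight_sets a b. card Z = k}) * \<alpha> ^ (?d - k) * t ^ k"
  have fin: "finite (tight_sets a b)"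
    by (rule finite_subset[of _ UNIV]) auto
  have "{Z \<in> tight_sets a b. card Z = 0} = {{}}"
    using S by (auto simp: simple_system_def)
  then have "f_polynomial (halfspaces a b) \<alpha> t = ?g 0 + (\<Sum>k=1..?d. ?g k)"
    unfolding f_polynomial_def
    by (simp add: Let_def simple_system_aff_dim[OF S] num_faces_simple_system[OF S])
  also have "\<dots> = (\<Sum>k\<in>{..?d}. ?g k)"
    by (simp add: atMost_atLeast0 sum.atLeast_Suc_atMost[of 0 ?d ?g])
  also have "\<dots> = (\<Sum>k\<in>{..?d}. \<Sum>Z | Z \<in> tight_sets a b \<and> card Z = k. \<alpha> ^ (?d - card Z) * t ^ card Z)"
    by (intro sum.cong) (auto simp: mult.assoc)
  also have "\<dots> = (\<Sum>Z\<in>tight_sets a b. \<alpha> ^ (?d - card Z) * t ^ card Z)"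
    using simple_system_card_le[OF S] fin by (intro sum.group) auto
  finally show ?thesis .
qed


text \<open>The tight face of a vertex is a single point, of dimension \<open>0\<close>.\<close>

lemma dim_tight_extreme_point:
  fixes a :: "'i::finite \<Rightarrow> 'a::euclidean_space"
  assumes v: "v extreme_point_of halfspaces a b"
  shows "dim (a ` tight a b v) = DIM('a)"
proof -
  have "{v} face_of halfspaces a b"
    using v by (simp add: face_of_singleton)
  then have "{v} = tight_face a b (tight a b v)"
    by (rule face_eq_tight_face) simp
  then have "aff_dim (tight_face a b (tight a b v)) = 0"
    by (metis aff_dim_sing)
  moreover have "tight a b v \<in> tight_sets a b"
    using v by (auto simp: tight_sets_def extreme_point_of_def)
  ultimately show ?thesis
    using aff_dim_tight_face[of "tight a b v" a b] by simp
qed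

text \<open>A facet is the locus where one inequality is tight, and there are as many facets as inequalities,
  so \<open>i \<mapsto> tight_face a b {i}\<close> is a bijection onto the facets. At a vertex the tight normals span the
  space, and simplicity says that there are only as many of them as the dimension, so they are
  independent. Every tight set is contained in that of a vertex, since every nonempty face of a
  polytope has a vertex.\<close>

lemma simple_polytope_imp_simple_system:
  fixes a :: "'i::finite \<Rightarrow> 'a::euclidean_space" and b :: "'i \<Rightarrow> real"
  defines "P \<equiv> halfspaces a b"
  assumes simple: "simple_polytope P"
    and full: "aff_dim P = int DIM('a)"
    and facets: "card {F. F facet_of P} = CARD('i)"
  shows "simple_system a b"
proof -
  let ?T = "\<lambda>i. tight_face a b {i}"
  have convP: "convex P"
    unfolding P_def by (rule convex_halfspaces)
  have faceT: "?T i face_of P" for i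
    unfolding P_def by (rule tight_face_face_of)
  have "{F. F facet_of P} \<subseteq> range ?T"
  proof
    fix F assume "F \<in> {F. F facet_of P}"
    then have F: "F face_of P" "F \<noteq> {}" "aff_dim F = aff_dim P - 1"
      by (auto simp: facet_of_def)
    then obtain y where "y \<in> rel_interior F"
      using rel_interior_eq_empty[OF face_of_imp_convex] by blast
    then have Fy: "F = tight_face a b (tight a b y)"
      using F(1) unfolding P_def by (intro face_eq_tight_face)
    have "F \<noteq> P" using F(3) by auto
    \<comment> \<open>a single inequality that is not an equation on \<open>P\<close> already cuts out \<open>F\<close>, by dimension\<close>
    then obtain i where i: "i \<in> tight a b y" "?T i \<noteq> P"
      unfolding Fy P_def tight_face_def by blast
    have "F \<subseteq> ?T i"
      using i(1) unfolding Fy by (auto simp: tight_face_def)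
    then have FT: "F face_of ?T i"
      by (rule face_of_subset[OF F(1) _ face_of_imp_subset[OF faceT]])
    have "F = ?T i"
    proof (rule ccontr)
      assume "F \<noteq> ?T i"
      then have "aff_dim F < aff_dim (?T i)"
        using FT face_of_imp_convex[OF faceT] by (intro face_of_aff_dim_lt)
      moreover have "aff_dim (?T i) < aff_dim P"
        using i(2) by (intro face_of_aff_dim_lt convP faceT)
      ultimately show False using F(3) by simp
    qed
    then show "F \<in> range ?T" by blast
  qed
  moreover have "card (range ?T) \<le> card {F. F facet_of P}"
    unfolding facets by (rule card_image_le) simp
  ultimately have rangeT: "{F. F facet_of P} = range ?T"
    by (intro card_seteq) auto
  with facets have injT: "inj ?T"
    by (intro eq_card_imp_inj_on) auto
  have facetT: "?T i facet_of P" for i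
    using rangeT by blast

  have ind_vertex: "independent_family a (tight a b v)" if v: "v extreme_point_of P" for v
  proof -
    have "v \<in> P" using v by (simp add: extreme_point_of_def)
    then have "{F. F facet_of P \<and> v \<in> F} = ?T ` tight a b v"
      using rangeT by (auto simp: tight_face_def P_def)
    moreover have "int (card {F. F facet_of P \<and> v \<in> F}) = int DIM('a)"
      using simple v full by (simp add: simple_polytope_def)
    ultimately have "card (tight a b v) = DIM('a)"
      using card_image[OF inj_on_subset[OF injT subset_UNIV], of "tight a b v"] by simp
    then show ?thesis
      using dim_tight_extreme_point v independent_family_iff_dim[of "tight a b v" a]
      unfolding P_def by simp
  qed
  have "independent_family a Z" if "Z \<in> tight_sets a b" for Z
  proof -
    have face: "tight_face a b Z face_of P"
      unfolding P_def by (rule tight_face_face_of)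
    have "tight_face a b Z \<noteq> {}"
      using that by (auto simp: tight_sets_def tight_face_def)
    moreover have "compact (tight_face a b Z)"
      using face simple by (meson face_of_imp_compact polytope_imp_compact polytope_imp_convex simple_polytope_def)
    ultimately obtain v where "v extreme_point_of tight_face a b Z"
      using extreme_point_exists_convex face_of_imp_convex[OF face] by blast
    then have "v extreme_point_of P" "v \<in> tight_face a b Z"
      using extreme_point_of_face[OF face] by auto
    then show ?thesis
      using independent_family_subset[OF ind_vertex] by (auto simp: tight_face_def)
  qed
  moreover have "{} \<in> tight_sets a b"
  proof -
    have "P \<noteq> {}" using full by auto
    then obtain y where y: "y \<in> rel_interior P"
      using rel_interior_eq_empty[OF convP] by blast
    then have Py: "P = tight_face a b (tight a b y)"
      using face_of_refl[OF convP] unfolding P_def by (intro face_eq_tight_face)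
    have "i \<notin> tight a b y" for i
    proof
      assume "i \<in> tight a b y"
      then have "P \<subseteq> ?T i"
        by (subst Py) (auto simp: tight_face_def)
      then have "?T i = P"
        using face_of_imp_subset[OF faceT] by blast
      then show False
        using facetT[of i] by (simp add: facet_of_def)
    qed
    then have "tight a b y = {}" by blast
    moreover have "y \<in> P" using y rel_interior_subset by blast
    ultimately show ?thesis
      by (auto simp: tight_sets_def P_def intro: rev_image_eqI)
  qed
  ultimately show ?thesis
    by (simp add: simple_system_def)
qed

section \<open>Splitting every slack\<close>

text \<open>Together with \<open>split_offsets\<close> below these are the inequalities \<open>w\<^sub>i \<ge> 0\<close> (index \<open>Inl i\<close>) and
  \<open>(x, a\<^sub>i) + b\<^sub>i - w\<^sub>i \<ge> 0\<close> (index \<open>Inr i\<close>) on pairs \<open>(x, w)\<close>.\<close>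

definition split_normals :: "('m::finite \<Rightarrow> 'a::euclidean_space) \<Rightarrow> 'm + 'm \<Rightarrow> 'a \<times> (real^'m)" where
  "split_normals a = case_sum (\<lambda>i. (0, axis i 1)) (\<lambda>i. (a i, - axis i 1))"

definition split_offsets :: "('m \<Rightarrow> real) \<Rightarrow> 'm + 'm \<Rightarrow> real" where
  "split_offsets b = case_sum (\<lambda>_. 0) b"

definition both :: "('m + 'm) set \<Rightarrow> 'm set" where
  "both Z = {i. Inl i \<in> Z \<and> Inr i \<in> Z}"

definition neither :: "('m + 'm) set \<Rightarrow> 'm set" where
  "neither Z = {i. Inl i \<notin> Z \<and> Inr i \<notin> Z}"

lemma split_slack [simp]:
  "(x, w) \<bullet> split_normals a (Inl i) + split_offsets b (Inl i) = w $ i"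
  "(x, w) \<bullet> split_normals a (Inr i) + split_offsets b (Inr i) = x \<bullet> a i + b i - w $ i"
  by (simp_all add: split_normals_def split_offsets_def inner_axis)

lemma halfspaces_split:
  "(x, w) \<in> halfspaces (split_normals a) (split_offsets b) \<longleftrightarrow>
    (\<forall>i. 0 \<le> w $ i \<and> w $ i \<le> x \<bullet> a i + b i)"
  by (simp add: halfspaces_def split_sum_all all_conj_distrib)

lemma mem_tight_split:
  "Inl i \<in> tight (split_normals a) (split_offsets b) (x, w) \<longleftrightarrow> w $ i = 0"
  "Inr i \<in> tight (split_normals a) (split_offsets b) (x, w) \<longleftrightarrow> w $ i = x \<bullet> a i + b i"
  by (auto simp: tight_def)

lemma tight_sets_split:
  fixes a :: "'m::finite \<Rightarrow> 'a::euclidean_space"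
  shows "Z \<in> tight_sets (split_normals a) (split_offsets b) \<longleftrightarrow> both Z \<in> tight_sets a b"
proof
  assume "Z \<in> tight_sets (split_normals a) (split_offsets b)"
  then obtain x w where xw: "(x, w) \<in> halfspaces (split_normals a) (split_offsets b)"
    and Z: "Z = tight (split_normals a) (split_offsets b) (x, w)"
    by (auto simp: tight_sets_def)
  have "0 \<le> x \<bullet> a i + b i" for i
    using xw by (meson halfspaces_split order_trans)
  moreover have "i \<in> both Z \<longleftrightarrow> i \<in> tight a b x" for i
  proof -
    have "0 \<le> w $ i" "w $ i \<le> x \<bullet> a i + b i"
      using xw by (auto simp: halfspaces_split)
    then show ?thesis
      unfolding both_def Z by (auto simp: mem_tight_split tight_def)
  qed
  ultimately show "both Z \<in> tight_sets a b"
    by (auto simp: tight_sets_def halfspaces_def intro!: image_eqI[of _ _ x])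
next
  assume "both Z \<in> tight_sets a b"
  then obtain x where x: "x \<in> halfspaces a b" and Z: "both Z = tight a b x"
    by (auto simp: tight_sets_def)
  \<comment> \<open>halving a slack keeps both of its parts positive\<close>
  define w :: "real^'m" where "w = (\<chi> i. if Inl i \<in> Z then 0 else
     if Inr i \<in> Z then x \<bullet> a i + b i else (x \<bullet> a i + b i) / 2)"
  have pos: "0 \<le> x \<bullet> a i + b i" for i
    using x by (simp add: halfspaces_def)
  have zero: "x \<bullet> a i + b i = 0 \<longleftrightarrow> Inl i \<in> Z \<and> Inr i \<in> Z" for i
    using Z by (auto simp: both_def tight_def)
  have "(x, w) \<in> halfspaces (split_normals a) (split_offsets b)"
    unfolding halfspaces_split
  proof
    fix i show "0 \<le> w $ i \<and> w $ i \<le> x \<bullet> a i + b i"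
      using pos[of i] by (auto simp: w_def)
  qed
  moreover have "s \<in> tight (split_normals a) (split_offsets b) (x, w) \<longleftrightarrow> s \<in> Z" for s
  proof (cases s)
    case (Inl i)
    then show ?thesis using zero[of i] by (auto simp: mem_tight_split w_def)
  next
    case (Inr i)
    then show ?thesis using zero[of i] by (auto simp: mem_tight_split w_def)
  qed
  ultimately show "Z \<in> tight_sets (split_normals a) (split_offsets b)"
    unfolding tight_sets_def by blast
qed

lemma sum_Plus_split:
  fixes Z :: "('m::finite + 'm) set"
  shows "(\<Sum>s\<in>Z. f s) = (\<Sum>i | Inl i \<in> Z. f (Inl i)) + (\<Sum>i | Inr i \<in> Z. f (Inr i))"
proof -
  have "Z = {i. Inl i \<in> Z} <+> {i. Inr i \<in> Z}"
    by (auto simp: Plus_def) (metis (mono_tags) image_eqI mem_Collect_eq sum.exhaust)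
  then have "sum f Z = sum f ({i. Inl i \<in> Z} <+> {i. Inr i \<in> Z})" by simp
  also have "\<dots> = (\<Sum>i | Inl i \<in> Z. f (Inl i)) + (\<Sum>i | Inr i \<in> Z. f (Inr i))"
    by (subst sum.Plus) auto
  finally show ?thesis .
qed

text \<open>In a linear relation the \<open>w\<close>-component shows that the two normals of slack \<open>i\<close> have equal
  coefficients, a missing normal counting as coefficient \<open>0\<close>. So only indices in \<open>both Z\<close> can
  contribute, and the \<open>x\<close>-component is a relation between their \<open>a\<^sub>i\<close>.\<close>

lemma independent_family_split:
  fixes a :: "'m::finite \<Rightarrow> 'a::euclidean_space"
  assumes "independent_family a (both Z)"
  shows "independent_family (split_normals a) Z"
  unfolding independent_family_def
proof (intro allI impI)
  fix r assume r: "(\<Sum>s\<in>Z. r s *\<^sub>R split_normals a s) = 0"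
  define p where "p = (\<lambda>i. if Inl i \<in> Z then r (Inl i) else 0)"
  define n where "n = (\<lambda>i. if Inr i \<in> Z then r (Inr i) else 0)"
  have fst: "(\<Sum>i\<in>UNIV. n i *\<^sub>R a i) = 0"
  proof -
    have "fst (\<Sum>s\<in>Z. r s *\<^sub>R split_normals a s) = (\<Sum>i | Inr i \<in> Z. r (Inr i) *\<^sub>R a i)"
      by (simp add: sum_Plus_split split_normals_def fst_sum)
    also have "\<dots> = (\<Sum>i\<in>UNIV. n i *\<^sub>R a i)"
      by (intro sum.mono_neutral_cong_left) (auto simp: n_def)
    finally show ?thesis using r by simp
  qed
  have snd: "p k = n k" for k
  proof -
    have "snd (\<Sum>s\<in>Z. r s *\<^sub>R split_normals a s) $ k =
       (\<Sum>i | Inl i \<in> Z. r (Inl i) * axis i 1 $ k) - (\<Sum>i | Inr i \<in> Z. r (Inr i) * axis i 1 $ k)"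
      by (simp add: sum_Plus_split split_normals_def snd_sum sum_negf)
    also have "\<dots> = p k - n k"
      by (simp add: axis_def p_def n_def sum.delta' if_distrib[of "\<lambda>x. _ * x"] cong: if_cong)
    finally show ?thesis using r by simp
  qed
  have "(\<Sum>i\<in>both Z. n i *\<^sub>R a i) = (\<Sum>i\<in>UNIV. n i *\<^sub>R a i)"
  proof (intro sum.mono_neutral_left ballI)
    fix i assume "i \<in> UNIV - both Z"
    then have "p i = 0 \<or> n i = 0" by (auto simp: both_def p_def n_def)
    with snd[of i] show "n i *\<^sub>R a i = 0" by auto
  qed auto
  with fst have "(\<Sum>i\<in>both Z. n i *\<^sub>R a i) = 0" by simp
  then have "n i = 0" if "i \<in> both Z" for i
    using independent_familyD[OF assms] that by blast
  moreover have "n i = 0" if "i \<notin> both Z" for i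
    using that snd[of i] by (auto simp: both_def p_def n_def split: if_splits)
  ultimately have n0: "n i = 0" for i by blast
  show "\<forall>s\<in>Z. r s = 0"
  proof
    fix s assume "s \<in> Z"
    then show "r s = 0"
      using n0 snd by (cases s) (auto simp: p_def n_def split: if_splits; metis)+
  qed
qed

lemma simple_system_split:
  fixes a :: "'m::finite \<Rightarrow> 'a::euclidean_space"
  assumes "simple_system a b"
  shows "simple_system (split_normals a) (split_offsets b)"
proof -
  have "both ({} :: ('m + 'm) set) = {}" by (simp add: both_def)
  with assms show ?thesis
    unfolding simple_system_def by (simp add: tight_sets_split independent_family_split)
qed

lemma card_neither_plus_card:
  fixes Z :: "('m::finite + 'm) set"
  shows "card (neither Z) + card Z = CARD('m) + card (both Z)"
proof -
  let ?L = "{i. Inl i \<in> Z}" and ?R = "{i. Inr i \<in> Z}"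
  have "card Z = card ?L + card ?R"
    using sum_Plus_split[of "\<lambda>_. 1::nat" Z] by simp
  also have "\<dots> = card (?L \<union> ?R) + card (?L \<inter> ?R)"
    by (rule card_Un_Int) auto
  also have "?L \<inter> ?R = both Z"
    by (auto simp: both_def)
  finally have "card Z = card (?L \<union> ?R) + card (both Z)" .
  moreover have "neither Z = - (?L \<union> ?R)"
    by (auto simp: neither_def)
  then have "card (neither Z) + card (?L \<union> ?R) = CARD('m)"
    by (simp add: Compl_eq_Diff_UNIV card_Diff_subset card_mono)
  ultimately show ?thesis by simp
qed

text \<open>Expand the product over all \<open>i\<close>, where an index in \<open>I\<close> offers the single choice that both parts
  vanish, of weight \<open>t\<^sup>2\<close>, and any other index the three remaining choices, of weights \<open>\<alpha>\<close>, \<open>t\<close>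
  and \<open>t\<close>.\<close>

lemma sum_fibre_both:
  fixes I :: "'m::finite set" and \<alpha> t :: "'r::comm_ring_1"
  shows "(\<Sum>Z | both Z = I. \<alpha> ^ card (neither Z) * t ^ card Z) =
    (t\<^sup>2) ^ card I * (\<alpha> + 2 * t) ^ (CARD('m) - card I)"
proof -
  define w :: "bool \<times> bool \<Rightarrow> 'r" where
    "w = (\<lambda>(l, r). (if \<not> l \<and> \<not> r then \<alpha> else 1) * ((if l then t else 1) * (if r then t else 1)))"
  define B where "B = (\<lambda>i. if i \<in> I then {(True, True)} else - {(True, True)})"
  have compl: "- {(True, True)} = {(False, False), (False, True), (True, False)}"
    by auto
  have w: "(\<Prod>i\<in>UNIV. w (Inl i \<in> Z, Inr i \<in> Z)) = \<alpha> ^ card (neither Z) * t ^ card Z"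
    for Z :: "('m + 'm) set"
  proof -
    have "t ^ card Z = (\<Prod>s\<in>UNIV <+> UNIV. if s \<in> Z then t else 1)"
      by (simp add: prod.If_cases)
    also have "\<dots> = (\<Prod>i\<in>UNIV. (if Inl i \<in> Z then t else 1) * (if Inr i \<in> Z then t else 1))"
      by (subst prod.Plus) (simp_all add: prod.distrib)
    finally have "t ^ card Z = \<dots>" .
    moreover have "\<alpha> ^ card (neither Z) =
        (\<Prod>i\<in>UNIV. if Inl i \<notin> Z \<and> Inr i \<notin> Z then \<alpha> else 1)"
      by (simp add: prod.If_cases neither_def)
    ultimately show ?thesis
      by (simp only: w_def case_prod_conv prod.distrib)
  qed
  have "(\<Sum>Z | both Z = I. \<alpha> ^ card (neither Z) * t ^ card Z) =
      (\<Sum>g\<in>PiE UNIV B. \<Prod>i\<in>UNIV. w (g i))"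
  proof (rule sum.reindex_bij_witness[where
        j = "\<lambda>Z i. (Inl i \<in> Z, Inr i \<in> Z)" and
        i = "\<lambda>g. Inl ` {i. fst (g i)} \<union> Inr ` {i. snd (g i)}"])
    fix Z :: "('m + 'm) set" assume "Z \<in> {Z. both Z = I}"
    then show "(\<lambda>i. (Inl i \<in> Z, Inr i \<in> Z)) \<in> PiE UNIV B"
      by (auto simp: B_def both_def)
    show "Inl ` {i. fst (Inl i \<in> Z, Inr i \<in> Z)} \<union> Inr ` {i. snd (Inl i \<in> Z, Inr i \<in> Z)} = Z"
    proof (rule set_eqI)
      fix s show "s \<in> Inl ` {i. fst (Inl i \<in> Z, Inr i \<in> Z)} \<union> Inr ` {i. snd (Inl i \<in> Z, Inr i \<in> Z)}
        \<longleftrightarrow> s \<in> Z"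
        by (cases s) auto
    qed
  next
    fix g assume g: "g \<in> PiE (UNIV :: 'm set) B"
    show "(\<lambda>i. (Inl i \<in> Inl ` {i. fst (g i)} \<union> Inr ` {i. snd (g i)},
                Inr i \<in> Inl ` {i. fst (g i)} \<union> Inr ` {i. snd (g i)})) = g"
      by (auto simp: fun_eq_iff prod_eq_iff)
    have "fst (g i) \<and> snd (g i) \<longleftrightarrow> i \<in> I" for i
      using PiE_mem[OF g, of i] by (auto simp: B_def prod_eq_iff split: if_splits)
    then show "Inl ` {i. fst (g i)} \<union> Inr ` {i. snd (g i)} \<in> {Z. both Z = I}"
      by (auto simp: both_def)
  qed (simp add: w)
  also have "\<dots> = (\<Prod>i\<in>UNIV. \<Sum>p\<in>B i. w p)"
    by (rule prod_sum_PiE[symmetric]) auto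
  also have "\<dots> = (\<Prod>i\<in>UNIV. if i \<in> I then t\<^sup>2 else \<alpha> + 2 * t)"
    by (intro prod.cong) (auto simp: B_def w_def compl power2_eq_square)
  also have "\<dots> = (t\<^sup>2) ^ card I * (\<alpha> + 2 * t) ^ (CARD('m) - card I)"
    by (simp add: prod.If_cases Compl_eq_Diff_UNIV card_Diff_subset)
  finally show ?thesis .
qed

text \<open>The dimension \<open>d + m - card Z\<close> of a face equals \<open>(d - card I) + card (neither Z)\<close> with
  \<open>I = both Z\<close>, so that the exponent of \<open>\<alpha>\<close> splits into a part depending only on \<open>I\<close> and one that
  can be summed over the fibre of \<open>I\<close>. As \<open>card I \<le> d \<le> m\<close>, the factor
  \<open>(\<alpha> + 2 * t) ^ (m - d)\<close> is common to all \<open>I\<close>.\<close>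

lemma f_polynomial_split:
  fixes a :: "'m::finite \<Rightarrow> 'a::euclidean_space" and \<alpha> t :: "'r::comm_ring_1"
  assumes S: "simple_system a b" and le: "DIM('a) \<le> CARD('m)"
  shows "f_polynomial (halfspaces (split_normals a) (split_offsets b)) \<alpha> t =
    (\<alpha> + 2 * t) ^ (CARD('m) - DIM('a)) * f_polynomial (halfspaces a b) (\<alpha> * (\<alpha> + 2 * t)) (t\<^sup>2)"
proof -
  let ?d = "DIM('a)" and ?m = "CARD('m)"
  have "f_polynomial (halfspaces (split_normals a) (split_offsets b)) \<alpha> t =
      (\<Sum>Z | both Z \<in> tight_sets a b. \<alpha> ^ (?d + ?m - card Z) * t ^ card Z)"
    by (simp add: f_polynomial_simple_system[OF simple_system_split[OF S]]
        tight_sets_split[symmetric])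
  also have "\<dots> = (\<Sum>I\<in>tight_sets a b. \<Sum>Z | Z \<in> {Z. both Z \<in> tight_sets a b} \<and> both Z = I.
      \<alpha> ^ (?d + ?m - card Z) * t ^ card Z)"
    by (rule sum.group[symmetric]) (auto intro: finite_subset[of _ UNIV])
  also have "\<dots> = (\<Sum>I\<in>tight_sets a b.
      (\<alpha> + 2 * t) ^ (?m - ?d) * ((\<alpha> * (\<alpha> + 2 * t)) ^ (?d - card I) * (t\<^sup>2) ^ card I))"
  proof (rule sum.cong[OF refl])
    fix I assume I: "I \<in> tight_sets a b"
    have card: "card I \<le> ?d"
      by (rule simple_system_card_le[OF S I])
    have "(\<Sum>Z | Z \<in> {Z. both Z \<in> tight_sets a b} \<and> both Z = I. \<alpha> ^ (?d + ?m - card Z) * t ^ card Z) =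
        (\<Sum>Z | both Z = I. \<alpha> ^ (?d - card I) * (\<alpha> ^ card (neither Z) * t ^ card Z))"
    proof (intro sum.cong)
      fix Z :: "('m + 'm) set" assume "Z \<in> {Z. both Z = I}"
      then have "?d + ?m - card Z = (?d - card I) + card (neither Z)"
        using card_neither_plus_card[of Z] card by auto
      then show "\<alpha> ^ (?d + ?m - card Z) * t ^ card Z =
          \<alpha> ^ (?d - card I) * (\<alpha> ^ card (neither Z) * t ^ card Z)"
        by (simp add: power_add mult.assoc)
    qed (use I in auto)
    also have "\<dots> = \<alpha> ^ (?d - card I) * ((t\<^sup>2) ^ card I * (\<alpha> + 2 * t) ^ (?m - card I))"
      by (simp only: sum_distrib_left[symmetric] sum_fibre_both)
    also have "?m - card I = (?m - ?d) + (?d - card I)"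
      using le card by simp
    finally show "(\<Sum>Z | Z \<in> {Z. both Z \<in> tight_sets a b} \<and> both Z = I.
        \<alpha> ^ (?d + ?m - card Z) * t ^ card Z) =
      (\<alpha> + 2 * t) ^ (?m - ?d) * ((\<alpha> * (\<alpha> + 2 * t)) ^ (?d - card I) * (t\<^sup>2) ^ card I)"
      by (simp add: power_add power_mult_distrib mult_ac)
  qed
  finally show ?thesis
    by (simp add: f_polynomial_simple_system[OF S] sum_distrib_left)
qed

section \<open>The double\<close>

lemma f_polynomial_injective_affine_image:
  fixes L :: "'a::euclidean_space \<Rightarrow> 'b::euclidean_space"
  assumes L: "linear L" "inj L"
  shows "f_polynomial ((+) v ` L ` S) \<alpha> t = f_polynomial S \<alpha> t"
proof -
  have num: "num_faces ((+) v ` L ` S) k = num_faces S k" for k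
  proof -
    have "{F. F face_of (+) v ` L ` S \<and> aff_dim F = int k} =
        (\<lambda>F. (+) v ` L ` F) ` {F. F face_of S \<and> aff_dim F = int k}" (is "?A = ?f ` ?B")
    proof
      show "?A \<subseteq> ?f ` ?B"
      proof
        fix F assume F: "F \<in> ?A"
        then have "F \<subseteq> (\<lambda>x. v + L x) ` S"
          using face_of_imp_subset by (auto simp: image_image)
        then obtain F' where "F = (\<lambda>x. v + L x) ` F'"
          by (rule subset_imageE)
        then have "F = ?f F'"
          by (simp add: image_image)
        with F show "F \<in> ?f ` ?B"
          by (auto simp: face_of_linear_image[OF L] aff_dim_translation_eq L)
      qed
      show "?f ` ?B \<subseteq> ?A"
        by (auto simp: face_of_linear_image[OF L] aff_dim_translation_eq L)
    qed
    moreover have "inj ?f"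
      using L(2) by (auto simp: inj_def inj_image_eq_iff)
    ultimately show ?thesis
      unfolding num_faces_def by (simp add: card_image inj_on_subset)
  qed
  show ?thesis
    unfolding f_polynomial_def num by (simp add: aff_dim_translation_eq L)
qed

lemma slack_map_nth: "slack_map a b x $ i = x \<bullet> a i + b i"
  by (simp add: slack_map_def matrix_vector_mul_component inner_commute)

text \<open>The coefficients \<open>c\<close> and \<open>q\<close> enter the double only through the affine subspace that they
  describe.\<close>

lemma double_iff:
  assumes "range (slack_map a b) = solution_set k c q"
  shows "z \<in> double k c q \<longleftrightarrow>
    (\<forall>s. 0 \<le> z $ s) \<and> (\<exists>x. \<forall>i. z $ Inl i + z $ Inr i = x \<bullet> a i + b i)"
proof -
  have "(\<forall>j\<in>{1..k}. (\<Sum>i\<in>UNIV. c j i * (z $ Inl i + z $ Inr i)) = q j) \<longleftrightarrow>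
      (\<chi> i. z $ Inl i + z $ Inr i) \<in> solution_set k c q"
    by (simp add: solution_set_def)
  also have "\<dots> \<longleftrightarrow> (\<exists>x. \<forall>i. z $ Inl i + z $ Inr i = x \<bullet> a i + b i)"
    unfolding assms[symmetric] by (auto simp: image_iff vec_eq_iff slack_map_nth)
  finally show ?thesis
    by (simp add: double_def)
qed

definition split_map :: "('m::finite \<Rightarrow> 'a::euclidean_space) \<Rightarrow> 'a \<times> (real^'m) \<Rightarrow> real^('m + 'm)" where
  "split_map a = (\<lambda>(x, w). \<chi> s. case s of Inl i \<Rightarrow> w $ i | Inr i \<Rightarrow> x \<bullet> a i - w $ i)"

lemma linear_split_map: "linear (split_map a)"
  by (rule linearI)
     (auto simp: split_map_def vec_eq_iff inner_add_left algebra_simps split: sum.split)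

text \<open>The coordinates of the image determine all \<open>(x, a\<^sub>i)\<close>, and the normals tight at a vertex already
  span the space.\<close>

lemma inj_split_map:
  fixes a :: "'m::finite \<Rightarrow> 'a::euclidean_space"
  assumes "v extreme_point_of halfspaces a b"
  shows "inj (split_map a)"
  unfolding linear_injective_0[OF linear_split_map]
proof (intro allI impI)
  fix p assume p: "split_map a p = 0"
  obtain x w where xw: "p = (x, w)" by (cases p)
  have w: "w $ i = 0" and x: "x \<bullet> a i - w $ i = 0" for i
    using arg_cong[OF p, of "\<lambda>z. z $ Inl i"] arg_cong[OF p, of "\<lambda>z. z $ Inr i"]
    by (simp_all add: xw split_map_def)
  have "dim {u. \<forall>i\<in>tight a b v. u \<bullet> a i = 0} = 0"
    using dim_orthogonal_family[of "tight a b v" a] dim_tight_extreme_point[OF assms] by simp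
  then have "{u. \<forall>i\<in>tight a b v. u \<bullet> a i = 0} \<subseteq> {0}"
    by simp
  then have "x = 0" using w x by auto
  with w show "p = 0" by (auto simp: xw vec_eq_iff zero_prod_def)
qed

lemma double_eq_image:
  fixes a :: "'m::finite \<Rightarrow> real^'n"
  assumes "range (slack_map a b) = solution_set k c q"
  shows "double k c q =
    (+) (\<chi> s. split_offsets b s) ` split_map a ` halfspaces (split_normals a) (split_offsets b)"
    (is "_ = (+) ?v ` _ ` ?H")
proof
  show "double k c q \<subseteq> (+) ?v ` split_map a ` ?H"
  proof
    fix z assume "z \<in> double k c q"
    then obtain x where z: "\<And>s. 0 \<le> z $ s" and x: "\<And>i. z $ Inl i + z $ Inr i = x \<bullet> a i + b i"
      unfolding double_iff[OF assms] by blast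
    have "z $ Inl i \<le> x \<bullet> a i + b i" for i
      using x[of i] z[of "Inr i"] by linarith
    then have "(x, \<chi> i. z $ Inl i) \<in> ?H"
      using z by (simp add: halfspaces_split)
    moreover have "z = ?v + split_map a (x, \<chi> i. z $ Inl i)"
      using x by (auto simp: vec_eq_iff split_map_def split_offsets_def algebra_simps split: sum.split)
    ultimately show "z \<in> (+) ?v ` split_map a ` ?H"
      by blast
  qed
next
  show "(+) ?v ` split_map a ` ?H \<subseteq> double k c q"
  proof clarify
    fix x w assume "(x, w) \<in> ?H"
    then have H: "0 \<le> w $ i" "w $ i \<le> x \<bullet> a i + b i" for i
      by (simp_all add: halfspaces_split)
    let ?z = "?v + split_map a (x, w)"
    have L: "?z $ Inl i = w $ i" and R: "?z $ Inr i = x \<bullet> a i + b i - w $ i" for i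
      by (simp_all add: split_map_def split_offsets_def)
    have "0 \<le> ?z $ s" for s
      using H by (cases s) (simp_all only: L R, simp)
    moreover have "?z $ Inl i + ?z $ Inr i = x \<bullet> a i + b i" for i
      by (simp only: L R)
    ultimately show "?z \<in> double k c q"
      unfolding double_iff[OF assms] by blast
  qed
qed

theorem theorem3:
  fixes a :: "'m::finite \<Rightarrow> real^'n" and b :: "'m \<Rightarrow> real"
    and c :: "nat \<Rightarrow> 'm \<Rightarrow> real" and q :: "nat \<Rightarrow> real"
    and \<alpha> t :: "'r::comm_ring_1"
  assumes "simple_polytope (ineq_polyhedron a b)"
    and "aff_dim (ineq_polyhedron a b) = int CARD('n)"
    and "card {F. F facet_of ineq_polyhedron a b} = CARD('m)"
    and "range (slack_map a b) = solution_set (CARD('m) - CARD('n)) c q"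
  shows "h_polynomial (double (CARD('m) - CARD('n)) c q) \<alpha> t =
         (\<alpha> + t) ^ (CARD('m) - CARD('n)) * h_polynomial (ineq_polyhedron a b) (\<alpha>\<^sup>2) (t\<^sup>2)"
proof -
  let ?P = "halfspaces a b"
  have P: "ineq_polyhedron a b = ?P"
    by (simp add: ineq_polyhedron_def halfspaces_def)
  have S: "simple_system a b"
    using assms(1-3) by (intro simple_polytope_imp_simple_system) (simp_all add: P)
  have "polytope ?P" "?P \<noteq> {}"
    using assms(1,2) by (auto simp: P simple_polytope_def)
  then obtain v where v: "v extreme_point_of ?P"
    using extreme_point_exists_convex polytope_imp_compact polytope_imp_convex by metis
  have "dim (a ` tight a b v) \<le> card (tight a b v)"
    by (meson card_image_le dim_le_card' finite finite_imageI order_trans)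
  also have "\<dots> \<le> CARD('m)"
    by (simp add: card_mono)
  finally have le: "DIM(real^'n) \<le> CARD('m)"
    by (simp only: dim_tight_extreme_point[OF v])
  \<comment> \<open>so the natural number subtraction in the exponent \<open>m - n\<close> does not truncate\<close>
  have "h_polynomial (double (CARD('m) - CARD('n)) c q) \<alpha> t =
      f_polynomial (halfspaces (split_normals a) (split_offsets b)) (\<alpha> - t) t"
    unfolding h_polynomial_def double_eq_image[OF assms(4)]
    by (rule f_polynomial_injective_affine_image[OF linear_split_map inj_split_map[OF v]])
  also have "\<dots> = (\<alpha> - t + 2 * t) ^ (CARD('m) - CARD('n)) *
      f_polynomial ?P ((\<alpha> - t) * (\<alpha> - t + 2 * t)) (t\<^sup>2)"
    using f_polynomial_split[OF S le, of "\<alpha> - t" t] by simp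
  also have "\<alpha> - t + 2 * t = \<alpha> + t"
    by simp
  also have "(\<alpha> - t) * (\<alpha> + t) = \<alpha>\<^sup>2 - t\<^sup>2"
    by (simp add: power2_eq_square algebra_simps)
  finally show ?thesis
    by (simp only: h_polynomial_def P)
qed

end
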